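(* Let $\mathcal{A}(\lambda)x=0$, with $\mathcal{A}(\lambda)=A_0+\sum_{i=1}^m\lambda_iA_i$, $A_i\in\mathbb{C}^{k\times\ell}$, $k=\ell+m-1$, be a rectangular multiparameter eigenvalue problem, and let $\lambda^*\neq0$ be an algebraically simple eigenvalue with corresponding eigenvector $x^*$. Let $B\in\mathbb{C}^{m\times m}$ be the auxiliary matrix with entries $B_{ij}=y_i^HA_jx^*$, $i,j=1,\dots,m$, where $y_1,\dots,y_m\in\mathbb{C}^k$ are linearly independent vectors in the left null space of $\mathcal{A}(\lambda^* )$. Then the norm-wise relative eigenvalue condition number of $\lambda^*$ is given by $$\kappa(\lambda^* )=\frac{\|B^{-1}\|_2}{\|\lambda^*\|_2}\,\gamma^*,$$ in which $\gamma^*=\|E_0\|_2+\sum_{i=1}^m|\lambda_i^*|\,\|E_i\|_2$ and $E_0,\dots,E_m\in\mathbb{C}^{k\times\ell}$ are the error matrices that bound the perturbations of $A_0,\dots,A_m$.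
   Context: $\|\cdot\|_2$ denotes the Euclidean norm of vectors and the induced (spectral) norm of matrices; $(\cdot)^H$ is the conjugate transpose. Rectangular multiparameter eigenvalue problem: $A_0,\dots,A_m\in\mathbb{C}^{k\times\ell}$, $k=\ell+m-1$, are such that $\mathcal{A}(\lambda)=A_0+\sum_{i=1}^m\lambda_iA_i$ has full normal rank (rank $\ell$ at a generic $\lambda\in\mathbb{C}^m$). An eigenvalue is $\lambda^*\in\mathbb{C}^m$ for which there is an eigenvector $x^*\in\mathbb{C}^\ell\setminus\{0\}$ with $\mathcal{A}(\lambda^* )x^*=0$. Secular equations: for the $L=\binom{k}{\ell}$ selections $\sigma_1,\dots,\sigma_L$ of $\ell$ out of $k$ rows, $\chi_i(\lambda)=\det[\mathcal{A}(\lambda)]_{\sigma_i}=0$, where $[\mathcal{A}(\lambda)]_{\sigma_i}$ is the submatrix formed by the rows in $\sigma_i$. The eigenvalues are the common roots of $\chi_1,\dots,\chi_L$. An eigenvalue $\lambda^*$ is algebraically simple if it is a simple common root of the secular equations, so that the $L\times m$ Jacobian $(\partial\chi_i/\partial\lambda_j)(\lambda^* )$ has full rank. The left null space of $\mathcal{A}(\lambda^* )$ is $\{y\in\mathbb{C}^k:\ y^H\mathcal{A}(\lambda^* )=0\}$; for an algebraically simple eigenvalue it has dimension $m$, and $B$ is nonsingular for any choice of basis vectors $y_1,\dots,y_m$ of it. The error matrices $E_i$ are fixed; the choice $E_i=A_i$ corresponds to relative perturbations and the choice $E_i=\mathbf{1}/\sqrt{k\ell}$ (with $\mathbf{1}$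 the all-ones matrix) to absolute perturbations. The norm-wise relative eigenvalue condition number is $$\kappa(\lambda^* )=\lim_{\epsilon\to0}\sup\frac{\|\Delta\lambda\|_2}{\epsilon\|\lambda^*\|_2},$$ the supremum being over all perturbations satisfying $$\Big(A_0+\Delta A_0+\sum_{i=1}^m(\lambda_i^*+\Delta\lambda_i)(A_i+\Delta A_i)\Big)(x^*+\Delta x)=0,\qquad \|\Delta A_i\|_2\le\epsilon\|E_i\|_2,\ i=0,1,\dots,m,$$ with $\Delta A_i\in\mathbb{C}^{k\times\ell}$, $\Delta\lambda\in\mathbb{C}^m$, $\Delta x\in\mathbb{C}^\ell$, together with the implicit requirement that $\Delta x\to0$ as $\epsilon\to0$.
   Formalization: The formal theorem assumes that x* has Euclidean norm 1 and that y_1,…,y_m are orthonormal, not merely linearly independent; without normalization the formula fails, since rescaling x* or the y_i changes ‖B^{-1}‖_2 but not κ(λ* ). *)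

theory Defs
  imports "HOL-Analysis.Analysis"
begin

text \<open>
  The index types \<open>'k\<close>, \<open>'l\<close>, \<open>'m\<close> stand for the ranges \<open>1..k\<close>, \<open>1..l\<close>, \<open>1..m\<close>, so a \<open>k x l\<close> matrix
  has type \<open>complex^'l^'k\<close>. The eigenvalue parameter is written \<open>\<mu>\<close>. The relation
  \<open>k = l + m - 1\<close> is a hypothesis on cardinalities.
\<close>

definition pencil ::
    "complex^'l^'k \<Rightarrow> ('m::finite \<Rightarrow> complex^'l^'k) \<Rightarrow> complex^'m \<Rightarrow> complex^'l^'k" where
  "pencil A0 A \<mu> = (\<chi> r c. A0 $ r $ c + (\<Sum>i\<in>UNIV. \<mu> $ i * A i $ r $ c))"

text \<open>The rank at a generic parameter is the largest rank attained.\<close>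

definition normal_rank ::
    "complex^'l^'k \<Rightarrow> ('m::finite \<Rightarrow> complex^'l^'k) \<Rightarrow> nat" where
  "normal_rank A0 A = Max (range (\<lambda>\<mu>. rank (pencil A0 A \<mu>)))"

definition eigenpair ::
    "complex^'l^'k \<Rightarrow> ('m::finite \<Rightarrow> complex^'l^'k) \<Rightarrow> complex^'m \<Rightarrow> complex^'l \<Rightarrow> bool" where
  "eigenpair A0 A \<mu> x \<longleftrightarrow> x \<noteq> 0 \<and> pencil A0 A \<mu> *v x = 0"

text \<open>
  A selection of \<open>l\<close> of the \<open>k\<close> rows is a set \<open>S\<close> of row indices with \<open>card S = l\<close>. The order in which
  the selected rows are listed affects the determinant only by its sign, so it is fixed by choice.
\<close>

definition row_selections :: "'l itself \<Rightarrow> 'k::finite set set" where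
  "row_selections _ = {S. card S = CARD('l)}"

definition select_rows :: "'k set \<Rightarrow> complex^'l^'k \<Rightarrow> complex^'l^'l" where
  "select_rows S M = (let \<sigma> = (SOME \<sigma>. bij_betw \<sigma> UNIV S) in \<chi> i. M $ \<sigma> i)"

definition secular ::
    "complex^'l^'k \<Rightarrow> ('m::finite \<Rightarrow> complex^'l^'k) \<Rightarrow> 'k set \<Rightarrow> complex^'m \<Rightarrow> complex" where
  "secular A0 A S \<mu> = det (select_rows S (pencil A0 A \<mu>))"

definition secular_gradient ::
    "complex^'l^'k \<Rightarrow> ('m::finite \<Rightarrow> complex^'l^'k) \<Rightarrow> 'k set \<Rightarrow> complex^'m \<Rightarrow> complex^'m" where
  "secular_gradient A0 A S \<mu> = (\<chi> j. deriv (\<lambda>t. secular A0 A S (\<mu> + axis j t)) 0)"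

text \<open>
  The gradients are the rows of the Jacobian of all secular equations; its row rank, the dimension
  of their complex span (\<open>vec.dim\<close>, as in the library's \<open>rank\<close>), must be \<open>m\<close>.
\<close>

definition algebraically_simple ::
    "complex^'l^'k \<Rightarrow> ('m::finite \<Rightarrow> complex^'l^'k) \<Rightarrow> complex^'m \<Rightarrow> bool" where
  "algebraically_simple A0 A \<mu> \<longleftrightarrow>
     (\<forall>S\<in>row_selections TYPE('l). secular A0 A S \<mu> = 0) \<and>
     vec.dim ((\<lambda>S. secular_gradient A0 A S \<mu>) ` row_selections TYPE('l)) = CARD('m)"

definition cnj_vec :: "complex^'n \<Rightarrow> complex^'n" where
  "cnj_vec v = (\<chi> i. cnj (v $ i))"

definition hdot :: "complex^'n \<Rightarrow> complex^'n \<Rightarrow> complex" where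
  "hdot y v = (\<Sum>i\<in>UNIV. cnj (y $ i) * v $ i)"

definition left_null_space :: "complex^'l^'k \<Rightarrow> (complex^'k) set" where
  "left_null_space M = {y. cnj_vec y v* M = 0}"

definition orthonormal_family :: "('m \<Rightarrow> complex^'k) \<Rightarrow> bool" where
  "orthonormal_family y \<longleftrightarrow> (\<forall>i j. hdot (y i) (y j) = (if i = j then 1 else 0))"

definition aux_matrix ::
    "('m \<Rightarrow> complex^'l^'k) \<Rightarrow> complex^'l \<Rightarrow> ('m \<Rightarrow> complex^'k) \<Rightarrow> complex^'m^'m" where
  "aux_matrix A x y = (\<chi> i j. hdot (y i) (A j *v x))"

text \<open>
  The norm of \<open>complex^'n\<close> is the Euclidean one, so \<open>onorm\<close> of the induced map is the spectral norm.
\<close>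

definition spectral_norm :: "complex^'n^'p \<Rightarrow> real" where
  "spectral_norm M = onorm (\<lambda>v. M *v v)"

text \<open>
  The eigenvalue shifts caused by perturbations of size \<open>\<epsilon>\<close> whose eigenvector shift has norm at
  most \<open>r\<close>.
\<close>

definition eigenvalue_shifts ::
    "complex^'l^'k \<Rightarrow> ('m::finite \<Rightarrow> complex^'l^'k) \<Rightarrow> complex^'l^'k \<Rightarrow> ('m \<Rightarrow> complex^'l^'k) \<Rightarrow>
     complex^'m \<Rightarrow> complex^'l \<Rightarrow> real \<Rightarrow> real \<Rightarrow> (complex^'m) set" where
  "eigenvalue_shifts A0 A E0 E \<mu> x \<epsilon> r =
     {\<Delta>\<mu>. \<exists>\<Delta>A0 \<Delta>A \<Delta>x.
        spectral_norm \<Delta>A0 \<le> \<epsilon> * spectral_norm E0 \<and>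
        (\<forall>i. spectral_norm (\<Delta>A i) \<le> \<epsilon> * spectral_norm (E i)) \<and>
        norm \<Delta>x \<le> r \<and>
        pencil (A0 + \<Delta>A0) (\<lambda>i. A i + \<Delta>A i) (\<mu> + \<Delta>\<mu>) *v (x + \<Delta>x) = 0}"

text \<open>The supremum is taken in \<open>ereal\<close>, where it is meaningful also for unbounded sets.\<close>

definition worst_relative_shift ::
    "complex^'l^'k \<Rightarrow> ('m::finite \<Rightarrow> complex^'l^'k) \<Rightarrow> complex^'l^'k \<Rightarrow> ('m \<Rightarrow> complex^'l^'k) \<Rightarrow>
     complex^'m \<Rightarrow> complex^'l \<Rightarrow> real \<Rightarrow> real \<Rightarrow> ereal" where
  "worst_relative_shift A0 A E0 E \<mu> x \<epsilon> r =
     (SUP \<Delta>\<mu>\<in>eigenvalue_shifts A0 A E0 E \<mu> x \<epsilon> r. ereal (norm \<Delta>\<mu> / (\<epsilon> * norm \<mu>)))"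

text \<open>
  The condition number is the limit for \<open>\<epsilon> \<rightarrow> 0+\<close> of the supremum over the perturbations of size \<open>\<epsilon>\<close>,
  subject to \<open>\<Delta>x \<rightarrow> 0\<close> as \<open>\<epsilon> \<rightarrow> 0\<close>. The latter is expressed by a vanishing bound
  \<open>norm \<Delta>x \<le> \<rho> \<epsilon>\<close>. As no rate is prescribed, the limit has to be the same for every
  \<open>\<rho>\<close> that vanishes slowly enough, that is, at least as slowly as some vanishing \<open>\<rho>\<^sub>0\<close>; a \<open>\<rho>\<close>
  that vanishes too fast (such as \<open>\<rho> = 0\<close>) would exclude the admissible families with
  \<open>\<Delta>x\<close> of order \<open>\<epsilon>\<close>. Every family with \<open>\<Delta>x \<rightarrow> 0\<close> is covered by some such \<open>\<rho>\<close>.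
\<close>

definition has_condition_number ::
    "complex^'l^'k \<Rightarrow> ('m::finite \<Rightarrow> complex^'l^'k) \<Rightarrow> complex^'l^'k \<Rightarrow> ('m \<Rightarrow> complex^'l^'k) \<Rightarrow>
     complex^'m \<Rightarrow> complex^'l \<Rightarrow> real \<Rightarrow> bool" where
  "has_condition_number A0 A E0 E \<mu> x \<kappa> \<longleftrightarrow>
     (\<exists>\<rho>\<^sub>0. (\<rho>\<^sub>0 \<longlongrightarrow> 0) (at_right 0) \<and>
        (\<forall>\<rho>. (\<rho> \<longlongrightarrow> 0) (at_right 0) \<and> (\<forall>\<^sub>F \<epsilon> in at_right 0. \<rho>\<^sub>0 \<epsilon> \<le> \<rho> \<epsilon>) \<longrightarrow>
           ((\<lambda>\<epsilon>. worst_relative_shift A0 A E0 E \<mu> x \<epsilon> (\<rho> \<epsilon>)) \<longlongrightarrow> ereal \<kappa>) (at_right 0)))"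

lemma has_condition_number_unique:
  assumes "has_condition_number A0 A E0 E \<mu> x \<kappa>" and "has_condition_number A0 A E0 E \<mu> x \<kappa>'"
  shows "\<kappa> = \<kappa>'"
proof -
  obtain \<rho> where \<rho>: "(\<rho> \<longlongrightarrow> 0) (at_right 0)"
    "\<And>\<tau>. (\<tau> \<longlongrightarrow> 0) (at_right 0) \<and> (\<forall>\<^sub>F \<epsilon> in at_right 0. \<rho> \<epsilon> \<le> \<tau> \<epsilon>) \<Longrightarrow>
       ((\<lambda>\<epsilon>. worst_relative_shift A0 A E0 E \<mu> x \<epsilon> (\<tau> \<epsilon>)) \<longlongrightarrow> ereal \<kappa>) (at_right 0)"
    using assms(1) unfolding has_condition_number_def by blast
  obtain \<rho>' where \<rho>': "(\<rho>' \<longlongrightarrow> 0) (at_right 0)"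
    "\<And>\<tau>. (\<tau> \<longlongrightarrow> 0) (at_right 0) \<and> (\<forall>\<^sub>F \<epsilon> in at_right 0. \<rho>' \<epsilon> \<le> \<tau> \<epsilon>) \<Longrightarrow>
       ((\<lambda>\<epsilon>. worst_relative_shift A0 A E0 E \<mu> x \<epsilon> (\<tau> \<epsilon>)) \<longlongrightarrow> ereal \<kappa>') (at_right 0)"
    using assms(2) unfolding has_condition_number_def by blast
  define \<tau> where "\<tau> \<epsilon> = max (\<rho> \<epsilon>) (\<rho>' \<epsilon>)" for \<epsilon>
  have "(\<tau> \<longlongrightarrow> 0) (at_right 0)"
    using tendsto_max[OF \<rho>(1) \<rho>'(1)] by (simp add: \<tau>_def[abs_def])
  moreover have "\<rho> \<epsilon> \<le> \<tau> \<epsilon>" "\<rho>' \<epsilon> \<le> \<tau> \<epsilon>" for \<epsilon>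
    by (simp_all add: \<tau>_def)
  ultimately have
    "((\<lambda>\<epsilon>. worst_relative_shift A0 A E0 E \<mu> x \<epsilon> (\<tau> \<epsilon>)) \<longlongrightarrow> ereal \<kappa>) (at_right 0)"
    "((\<lambda>\<epsilon>. worst_relative_shift A0 A E0 E \<mu> x \<epsilon> (\<tau> \<epsilon>)) \<longlongrightarrow> ereal \<kappa>') (at_right 0)"
    using \<rho>(2)[of \<tau>] \<rho>'(2)[of \<tau>] by simp_all
  then have "ereal \<kappa> = ereal \<kappa>'"
    by (rule tendsto_unique[OF trivial_limit_at_right_real])
  then show ?thesis by simp
qed

end

theory Submission
  imports Defs
begin

text \<open>
  Write \<open>M\<close> for the pencil at \<open>\<mu>\<close> and \<open>B\<close> for the auxiliary matrix, and let \<open>y\<^sub>1, \<dots>, y\<^sub>m\<close> be the given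
  orthonormal vectors with \<open>y\<^sub>i\<^sup>H M = 0\<close>.
  
  \<^emph>\<open>The matrix \<open>B\<close> is invertible.\<close> If \<open>N x = 0\<close> and \<open>x\<^sub>k \<noteq> 0\<close>, Cramer's rule shows that
  \<open>det (N + t C)\<close> has derivative \<open>det (N with column k replaced by C x) / x\<^sub>k\<close> at \<open>t = 0\<close>
  (\<open>det_line_has_derivative\<close>). Applied to the selected rows of the pencil, this expresses the gradients
  of the secular equations through the vectors \<open>A\<^sub>j x\<close> (\<open>secular_gradient_sum\<close>). Since the gradients
  span \<open>\<complex>\<^sup>m\<close>, two things cannot happen: a second independent kernel vector of \<open>M\<close> would make all
  gradients zero (\<open>simple_kernel\<close>), and a direction \<open>c \<noteq> 0\<close> for which \<open>\<Sum>\<^sub>j c\<^sub>j A\<^sub>j x\<close> is in the range of \<open>M\<close>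
  would annihilate all gradients (\<open>simple_direction\<close>). The first fact gives \<open>M\<close> rank \<open>l - 1\<close>, so by dimension count every
  vector of \<open>\<complex>\<^sup>k\<close> is a combination of the \<open>y\<^sub>i\<close> plus a vector \<open>M z\<close> (\<open>simple_decomposition\<close>). If
  \<open>B c = 0\<close>, the part of \<open>\<Sum>\<^sub>j c\<^sub>j A\<^sub>j x\<close> along the \<open>y\<^sub>i\<close> vanishes, and the second fact yields \<open>c = 0\<close>.
  
  \<^emph>\<open>Upper bound.\<close> Projecting the perturbed equation onto the \<open>y\<^sub>i\<close> removes \<open>M\<close> and leaves
  \<open>B \<Delta>\<mu> = - Y\<^sup>H (\<Delta>A\<^sub>0 + \<Sum>\<^sub>j \<mu>\<^sub>j \<Delta>A\<^sub>j) (x + \<Delta>x)\<close> up to a term of size \<open>o(1) \<Delta>\<mu>\<close>. By Bessel's inequality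
  the right-hand side has norm at most \<open>\<epsilon> \<gamma> (1 + o(1))\<close> (\<open>shift_upper_bound\<close>). Absorbing the
  error term on the left then also shows \<open>\<Delta>\<mu> = O(\<epsilon>)\<close> uniformly, although \<open>\<Delta>\<mu>\<close> is not bounded a priori.
  
  \<^emph>\<open>Lower bound.\<close> Instead of solving a perturbed problem by the implicit function theorem, the solution
  is prescribed and a perturbation is found for it. A pair \<open>(\<nu>, v)\<close> solves a problem within tolerance
  \<open>\<epsilon>\<close> as soon as its residual is at most \<open>\<epsilon> (\<parallel>E\<^sub>0\<parallel> + \<Sum>\<^sub>i \<bar>\<nu>\<^sub>i\<bar> \<parallel>E\<^sub>i\<parallel>) \<parallel>v\<parallel>\<close>; rank-one perturbations
  suffice (\<open>backward_error\<close>). For a unit vector \<open>u\<close> take \<open>\<nu> = \<mu> - s B\<inverse> u\<close> and \<open>v = x - s z\<close>, where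
  \<open>z\<close> cancels the part of the first-order residual in the range of \<open>M\<close>. The residual is then
  \<open>s + O(s\<^sup>2)\<close>, which is admissible for \<open>s = \<theta> \<gamma> \<epsilon>\<close> with any \<open>\<theta> < 1\<close> and small \<open>\<epsilon>\<close>
  (\<open>shift_lower_bound\<close>). Letting \<open>\<theta>\<close> tend to 1 and \<open>\<parallel>B\<inverse> u\<parallel>\<close> to \<open>\<parallel>B\<inverse>\<parallel>\<close> gives the claim. As
  \<open>\<Delta>x = O(\<epsilon>)\<close> here, the slowly vanishing radius \<open>\<rho>\<^sub>0 \<epsilon> = \<surd>\<epsilon>\<close> admits these families for all \<open>u\<close> and
  \<open>\<theta>\<close> at once.
\<close>

section \<open>The derivative of a determinant at a singular matrix\<close>

definition repl_col :: "'l \<Rightarrow> complex^'l \<Rightarrow> complex^'l^'l \<Rightarrow> complex^'l^'l" where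
  "repl_col k v N = (\<chi> i j. if j = k then v $ i else N $ i $ j)"

lemma det_repl_col_range: "det (repl_col k (N *v z) N) = z $ k * det N"
  unfolding repl_col_def by (rule cramer_lemma)

lemma det_repl_col_alt:
  "det (repl_col k v N) = det (\<chi> i. if i = k then v else transpose N $ i)"
proof -
  have "transpose (repl_col k v N) = (\<chi> i. if i = k then v else transpose N $ i)"
    by (simp add: repl_col_def transpose_def vec_eq_iff)
  then show ?thesis by (metis det_transpose)
qed

lemma det_repl_col_add:
  "det (repl_col k (v + w) N) = det (repl_col k v N) + det (repl_col k w N)"
  unfolding det_repl_col_alt by (rule det_row_add)

lemma det_repl_col_scale: "det (repl_col k (a *s v) N) = a * det (repl_col k v N)"
  unfolding det_repl_col_alt by (rule det_row_mul)

lemma det_repl_col_sum: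
  "det (repl_col k (\<Sum>j\<in>J. a j *s v j) N) = (\<Sum>j\<in>J. a j * det (repl_col k (v j) N))"
proof (induction J rule: infinite_finite_induct)
  case empty
  show ?case using det_repl_col_scale[of k 0 0 N] by simp
next
  case (infinite J)
  then show ?case using det_repl_col_scale[of k 0 0 N] by simp
qed (simp_all add: det_repl_col_add det_repl_col_scale)

text \<open>
  A kernel vector of \<open>N\<close> with vanishing \<open>k\<close>-th entry does not see column \<open>k\<close>, so it stays in the kernel
  whatever that column is replaced by.
\<close>

lemma det_repl_col_eq_0:
  assumes "N *v z = 0" and "z $ k = 0" and "z \<noteq> 0"
  shows "det (repl_col k v N) = 0"
proof -
  have "(if j = k then v $ i else N $ i $ j) * z $ j = N $ i $ j * z $ j" for i j
    using assms(2) by simp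
  then have "repl_col k v N *v z = N *v z"
    by (simp only: repl_col_def matrix_vector_mult_def vec_lambda_beta)
  then have "repl_col k v N *v z = 0" using assms(1) by simp
  then show ?thesis
    using assms(3) by (metis invertible_det_nz invertible_left_inverse matrix_left_invertible_ker)
qed

text \<open>
  Because \<open>(N + t C) x = t C x\<close>, Cramer's rule gives
  \<open>x\<^sub>k det (N + t C) = t det (N + t C with column k replaced by C x)\<close>. So the difference
  quotient at \<open>t = 0\<close> is \<open>1 / x\<^sub>k\<close> times the second determinant, which is continuous in \<open>t\<close>.
\<close>

lemma det_line_has_derivative:
  fixes N C :: "complex^'l^'l"
  assumes Nx: "N *v x = 0" and xk: "x $ k \<noteq> 0"
  shows "((\<lambda>t. det (\<chi> i j. N $ i $ j + t * C $ i $ j))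
           has_field_derivative det (repl_col k (C *v x) N) / x $ k) (at 0)"
proof -
  define P where "P t = (\<chi> i j. N $ i $ j + t * C $ i $ j)" for t
  define g where "g t = det (repl_col k (C *v x) (P t)) / x $ k" for t
  have Px: "P t *v x = t *s (C *v x)" for t
  proof -
    have "(P t *v x) $ i = (N *v x) $ i + t * (C *v x) $ i" for i
      by (simp add: P_def matrix_vector_mult_def algebra_simps sum.distrib sum_distrib_left)
    then show ?thesis using Nx by (simp add: vec_eq_iff)
  qed
  have det_P: "det (P t) = t * g t" for t
    using det_repl_col_range[of k "P t" x] xk by (simp add: g_def Px det_repl_col_scale)
  have "(g \<longlongrightarrow> g 0) (at 0)"
  proof -
    have entry: "((\<lambda>t. repl_col k (C *v x) (P t) $ i $ j) \<longlongrightarrow> repl_col k (C *v x) (P 0) $ i $ j) (at 0)"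
      for i j
      by (cases "j = k") (auto simp: repl_col_def P_def intro!: tendsto_eq_intros)
    show ?thesis
      unfolding g_def det_def by (intro tendsto_intros entry xk)
  qed
  moreover have "P 0 = N" by (simp add: P_def vec_eq_iff)
  moreover have "(det (P (0 + h)) - det (P 0)) / h = g h" if "h \<noteq> 0" for h
    using that by (simp add: det_P)
  then have "\<forall>\<^sub>F h in at 0. g h = (det (P (0 + h)) - det (P 0)) / h"
    by (simp add: eventually_at_filter)
  ultimately have "((\<lambda>h. (det (P (0 + h)) - det (P 0)) / h) \<longlongrightarrow> g 0) (at 0)"
    by (blast intro: Lim_transform_eventually)
  moreover have "g 0 = det (repl_col k (C *v x) N) / x $ k"
    using \<open>P 0 = N\<close> by (simp add: g_def)
  ultimately show ?thesis
    unfolding P_def DERIV_def by simp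
qed

section \<open>Gradients of the secular equations\<close>

lemma pencil_mult:
  fixes A0 :: "complex^'l^'k"
  shows "pencil A0 A \<mu> *v v = A0 *v v + (\<Sum>i\<in>UNIV. \<mu> $ i *s (A i *v v))"
proof -
  have "(\<Sum>c\<in>UNIV. (\<Sum>i\<in>UNIV. \<mu> $ i * A i $ r $ c) * v $ c) =
        (\<Sum>i\<in>UNIV. \<Sum>c\<in>UNIV. \<mu> $ i * (A i $ r $ c * v $ c))" for r
    by (subst sum.swap) (simp add: sum_distrib_right mult.assoc)
  then show ?thesis
    by (simp add: vec_eq_iff pencil_def matrix_vector_mult_def distrib_right sum.distrib
        sum_distrib_left)
qed

lemma select_rows_mult: "(select_rows S M *v v) $ i = (M *v v) $ (SOME \<sigma>. bij_betw \<sigma> UNIV S) i"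
  by (simp add: select_rows_def Let_def matrix_vector_mult_def)

lemma secular_line:
  "secular A0 A S (\<mu> + axis j t) =
    det (\<chi> r c. select_rows S (pencil A0 A \<mu>) $ r $ c + t * select_rows S (A j) $ r $ c)"
proof -
  have "(\<Sum>i\<in>UNIV. axis j t $ i * A i $ r $ c) = t * A j $ r $ c" for r c
    by (subst sum.remove[of _ j]) (simp_all add: axis_def)
  then have "select_rows S (pencil A0 A (\<mu> + axis j t)) =
    (\<chi> r c. select_rows S (pencil A0 A \<mu>) $ r $ c + t * select_rows S (A j) $ r $ c)"
    by (simp add: vec_eq_iff select_rows_def Let_def pencil_def distrib_right sum.distrib)
  then show ?thesis by (simp add: secular_def)
qed

text \<open>
  The right-hand side depends on the direction \<open>c\<close> only through \<open>\<Sum>\<^sub>j c\<^sub>j A\<^sub>j x\<close>. This turns the condition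
  on the Jacobian into a statement on these vectors relative to the range of the pencil.
\<close>

lemma secular_gradient_sum:
  fixes A0 :: "complex^'l^'k"
  assumes Mx: "pencil A0 A \<mu> *v x = 0" and xk: "x $ k \<noteq> 0"
  shows "(\<Sum>j\<in>UNIV. c $ j * secular_gradient A0 A S \<mu> $ j) =
    det (repl_col k (\<Sum>j\<in>UNIV. c $ j *s (select_rows S (A j) *v x))
      (select_rows S (pencil A0 A \<mu>))) / x $ k"
proof -
  have "select_rows S (pencil A0 A \<mu>) *v x = 0"
    using Mx by (simp add: vec_eq_iff select_rows_mult)
  note d = det_line_has_derivative[OF this xk]
  have "secular_gradient A0 A S \<mu> $ j =
    det (repl_col k (select_rows S (A j) *v x) (select_rows S (pencil A0 A \<mu>))) / x $ k" for j
    unfolding secular_gradient_def secular_line using DERIV_imp_deriv[OF d] by simp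
  then show ?thesis by (simp add: det_repl_col_sum sum_divide_distrib)
qed

lemma simple_gradient_nonzero:
  fixes A0 :: "complex^'l^'k" and A :: "'m::finite \<Rightarrow> complex^'l^'k"
  assumes simple: "algebraically_simple A0 A \<mu>"
    and orth: "\<And>S. S \<in> row_selections TYPE('l) \<Longrightarrow>
      (\<Sum>j\<in>UNIV. c $ j * secular_gradient A0 A S \<mu> $ j) = 0"
  shows "c = 0"
proof -
  define G where "G = (\<lambda>S. secular_gradient A0 A S \<mu>) ` row_selections TYPE('l)"
  define H where "H = {g::complex^'m. (\<Sum>j\<in>UNIV. c $ j * g $ j) = 0}"
  have "vec.subspace H"
    by (auto simp: H_def vec.subspace_def algebra_simps sum.distrib sum_distrib_left[symmetric])
  moreover have "G \<subseteq> H" using orth by (auto simp: G_def H_def)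
  ultimately have "vec.span G \<subseteq> H" by (simp add: vec.span_minimal)
  moreover have "vec.span G = UNIV"
    using simple unfolding algebraically_simple_def G_def
    by (metis vec.dim_eq_full vec.dim_UNIV vec_dim_card vec.dimension_def)
  ultimately have "axis j 1 \<in> H" for j by auto
  moreover have "(\<Sum>i\<in>UNIV. c $ i * axis j 1 $ i) = c $ j" for j
    by (subst sum.remove[of _ j]) (simp_all add: axis_def)
  ultimately show ?thesis by (simp add: H_def vec_eq_iff)
qed

text \<open>
  Geometric simplicity: modulo \<open>x\<close> every kernel vector has vanishing \<open>k\<close>-th entry, so a second kernel
  direction would make all secular gradients zero.
\<close>

lemma simple_kernel:
  fixes A0 :: "complex^'l^'k" and A :: "'m::finite \<Rightarrow> complex^'l^'k"
  assumes simple: "algebraically_simple A0 A \<mu>"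
    and Mx: "pencil A0 A \<mu> *v x = 0" and xk: "x $ k \<noteq> 0"
    and Mz: "pencil A0 A \<mu> *v z = 0" and zk: "z $ k = 0"
  shows "z = 0"
proof (rule ccontr)
  assume "z \<noteq> 0"
  have "(1 :: complex^'m) = 0"
  proof (rule simple_gradient_nonzero[OF simple])
    fix S :: "'k set"
    have "select_rows S (pencil A0 A \<mu>) *v z = 0"
      using Mz by (simp add: vec_eq_iff select_rows_mult)
    then show "(\<Sum>j\<in>UNIV. 1 $ j * secular_gradient A0 A S \<mu> $ j) = 0"
      unfolding secular_gradient_sum[OF Mx xk] using zk \<open>z \<noteq> 0\<close>
      by (simp add: det_repl_col_eq_0)
  qed
  then show False by (simp add: vec_eq_iff)
qed

text \<open>
  If \<open>\<Sum>\<^sub>j c\<^sub>j A\<^sub>j x = M z\<close>, the replaced column is \<open>M z\<close> as well, and Cramer's rule gives the determinant as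
  a multiple of the secular function, which vanishes at the eigenvalue. Hence \<open>c\<close> annihilates all gradients.
\<close>

lemma simple_direction:
  fixes A0 :: "complex^'l^'k" and A :: "'m::finite \<Rightarrow> complex^'l^'k"
  assumes simple: "algebraically_simple A0 A \<mu>"
    and eigen: "eigenpair A0 A \<mu> x"
    and range: "(\<Sum>j\<in>UNIV. c $ j *s (A j *v x)) = pencil A0 A \<mu> *v z"
  shows "c = 0"
proof (rule simple_gradient_nonzero[OF simple])
  fix S :: "'k set" assume S: "S \<in> row_selections TYPE('l)"
  obtain k where xk: "x $ k \<noteq> 0" using eigen by (auto simp: eigenpair_def vec_eq_iff)
  have Mx: "pencil A0 A \<mu> *v x = 0" using eigen by (simp add: eigenpair_def)
  have "det (select_rows S (pencil A0 A \<mu>)) = 0"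
    using simple S by (simp add: algebraically_simple_def secular_def)
  moreover have "(\<Sum>j\<in>UNIV. c $ j *s (select_rows S (A j) *v x)) = select_rows S (pencil A0 A \<mu>) *v z"
    unfolding vec_eq_iff
    by (simp add: select_rows_mult range[symmetric])
  ultimately show "(\<Sum>j\<in>UNIV. c $ j * secular_gradient A0 A S \<mu> $ j) = 0"
    by (simp add: secular_gradient_sum[OF Mx xk] det_repl_col_range)
qed

section \<open>Orthonormal families and the Hermitian form\<close>

lemma hdot_add_right: "hdot y (v + w) = hdot y v + hdot y w"
  by (simp add: hdot_def algebra_simps sum.distrib)

lemma hdot_scale_right: "hdot y (a *s v) = a * hdot y v"
  by (simp add: hdot_def sum_distrib_left ac_simps)

lemma hdot_sum_right: "hdot y (\<Sum>j\<in>J. f j) = (\<Sum>j\<in>J. hdot y (f j))"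
  by (induction J rule: infinite_finite_induct) (simp_all add: hdot_add_right, simp_all add: hdot_def)

lemma hdot_commute: "hdot v y = cnj (hdot y v)"
  by (simp add: hdot_def ac_simps)

lemma hdot_self: "hdot v v = of_real ((norm v)\<^sup>2)"
proof -
  have "(norm v)\<^sup>2 = (\<Sum>i\<in>UNIV. (norm (v $ i))\<^sup>2)"
    by (simp add: norm_vec_def L2_set_def sum_nonneg)
  then show ?thesis
    by (simp add: hdot_def complex_norm_square mult.commute del: of_real_power)
qed

lemma norm_hdot_le: "norm (hdot y v) \<le> norm y * norm v"
proof -
  have "norm (hdot y v) \<le> (\<Sum>i\<in>UNIV. \<bar>norm (y $ i)\<bar> * \<bar>norm (v $ i)\<bar>)"
    unfolding hdot_def by (rule order_trans[OF norm_sum]) (simp add: norm_mult)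
  also have "\<dots> \<le> norm y * norm v"
    unfolding norm_vec_def by (rule L2_set_mult_ineq)
  finally show ?thesis .
qed

lemma norm_vector_scale: "norm (a *s v) = norm a * norm v"
  for v :: "complex^'n"
  by (simp add: norm_vec_def norm_mult L2_set_right_distrib)

text \<open>
  These two maps are the matrices \<open>Y\<^sup>H\<close> and \<open>Y\<close>, where \<open>Y\<close> has the columns \<open>y i\<close>.
\<close>

definition coords :: "('m::finite \<Rightarrow> complex^'k) \<Rightarrow> complex^'k \<Rightarrow> complex^'m" where
  "coords y v = (\<chi> i. hdot (y i) v)"

definition combine :: "('m::finite \<Rightarrow> complex^'k) \<Rightarrow> complex^'m \<Rightarrow> complex^'k" where
  "combine y a = (\<Sum>i\<in>UNIV. a $ i *s y i)"

lemma coords_add: "coords y (v + w) = coords y v + coords y w"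
  by (simp add: coords_def vec_eq_iff hdot_add_right)

lemma coords_combine:
  assumes "orthonormal_family y"
  shows "coords y (combine y a) = a"
proof -
  have "(\<Sum>j\<in>UNIV. a $ j * hdot (y i) (y j)) = a $ i" for i
  proof -
    have "a $ j * hdot (y i) (y j) = (if i = j then a $ j else 0)" for j
      using assms by (simp add: orthonormal_family_def)
    then show ?thesis by simp
  qed
  then show ?thesis
    by (simp add: coords_def combine_def vec_eq_iff hdot_sum_right hdot_scale_right)
qed

lemma hdot_combine: "hdot v (combine y a) = hdot (coords y v) a"
  unfolding hdot_def[of "coords y v"]
  by (simp add: combine_def hdot_sum_right hdot_scale_right coords_def hdot_commute[of v] mult.commute)

lemma norm_combine:
  assumes "orthonormal_family y"
  shows "norm (combine y a) = norm a"
proof -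
  have "complex_of_real ((norm (combine y a))\<^sup>2) = of_real ((norm a)\<^sup>2)"
    unfolding hdot_self[symmetric] hdot_combine coords_combine[OF assms] ..
  then have "(norm (combine y a))\<^sup>2 = (norm a)\<^sup>2" using of_real_eq_iff by blast
  then show ?thesis by simp
qed

lemma bessel:
  assumes "orthonormal_family y"
  shows "norm (coords y v) \<le> norm v"
proof -
  have "(norm (coords y v))\<^sup>2 = norm (hdot v (combine y (coords y v)))"
    unfolding hdot_combine hdot_self by (simp add: norm_power)
  also have "\<dots> \<le> norm v * norm (coords y v)"
    using norm_hdot_le[of v "combine y (coords y v)"] by (simp add: norm_combine[OF assms])
  finally show ?thesis
    by (cases "coords y v = 0") (simp_all add: power2_eq_square)
qed

lemma coords_range:
  assumes "\<forall>i. y i \<in> left_null_space M"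
  shows "coords y (M *v z) = 0"
proof -
  have "hdot (y i) (M *v z) = (\<Sum>c\<in>UNIV. (cnj_vec (y i) v* M) $ c * z $ c)" for i
  proof -
    have "hdot (y i) (M *v z) = (\<Sum>r\<in>UNIV. \<Sum>c\<in>UNIV. cnj (y i $ r) * M $ r $ c * z $ c)"
      by (simp add: hdot_def matrix_vector_mult_def sum_distrib_left mult.assoc)
    also have "\<dots> = (\<Sum>c\<in>UNIV. (cnj_vec (y i) v* M) $ c * z $ c)"
      by (subst sum.swap)
        (simp add: cnj_vec_def vector_matrix_mult_def sum_distrib_left ac_simps)
    finally show ?thesis .
  qed
  then show ?thesis
    using assms by (simp add: coords_def left_null_space_def vec_eq_iff)
qed

section \<open>Invertibility of the auxiliary matrix\<close>

text \<open>
  A dimension count. The map \<open>(a, z) \<mapsto> Y a + M z\<close> from \<open>\<complex>\<^sup>m\<^sup>+\<^sup>l\<close> to \<open>\<complex>\<^sup>k\<close> has a one-dimensional excess in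
  its domain; adjoining the coordinate \<open>z\<^sub>k\<close> to the target makes it a map between spaces of equal dimension,
  which is injective and hence surjective.
\<close>

lemma combine_add_range_surj:
  fixes M :: "complex^'l^'k" and y :: "'m::finite \<Rightarrow> complex^'k"
  assumes dims: "CARD('k) + 1 = CARD('m) + CARD('l)"
    and orth: "orthonormal_family y" and null: "\<forall>i. y i \<in> left_null_space M"
    and kernel: "\<And>z. M *v z = 0 \<Longrightarrow> z $ k = 0 \<Longrightarrow> z = 0"
  obtains a z where "w = combine y a + M *v z"
proof -
  define G :: "complex^('m + 'l)^('k option)" where
    "G = (\<chi> r s. case r of
        None \<Rightarrow> (if s = Inr k then 1 else 0)
      | Some p \<Rightarrow> (case s of Inl i \<Rightarrow> y i $ p | Inr c \<Rightarrow> M $ p $ c))"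
  define fst_part snd_part where "fst_part v = (\<chi> i. v $ Inl i)" and "snd_part v = (\<chi> c. v $ Inr c)"
    for v :: "complex^('m + 'l)"
  have sum_split: "(\<Sum>s\<in>UNIV. f s) = (\<Sum>i\<in>UNIV. f (Inl i)) + (\<Sum>c\<in>UNIV. f (Inr c))"
    for f :: "'m + 'l \<Rightarrow> complex"
    unfolding UNIV_sum by (subst sum.union_disjoint) (auto simp: sum.reindex)
  have G_Some: "(G *v v) $ Some p = (combine y (fst_part v) + M *v snd_part v) $ p" for v p
    by (simp add: G_def matrix_vector_mult_def sum_split combine_def fst_part_def snd_part_def
        mult.commute)
  have "(\<Sum>s\<in>UNIV. (if s = Inr k then 1 else 0) * v $ s) = v $ Inr k" for v :: "complex^('m + 'l)"
    by (subst sum.remove[of _ "Inr k"]) simp_all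
  then have G_None: "(G *v v) $ None = v $ Inr k" for v
    by (simp add: G_def matrix_vector_mult_def)
  have "v = 0" if "G *v v = 0" for v
  proof -
    have *: "combine y (fst_part v) + M *v snd_part v = 0"
      using that G_Some[of v] by (simp add: vec_eq_iff)
    have "fst_part v = coords y (combine y (fst_part v) + M *v snd_part v)"
      by (simp add: coords_add coords_combine[OF orth] coords_range[OF null])
    then have fst0: "fst_part v = 0" by (simp add: * coords_def hdot_def vec_eq_iff)
    then have "M *v snd_part v = 0" using * by (simp add: combine_def)
    moreover have "snd_part v $ k = 0" using that G_None[of v] by (simp add: snd_part_def)
    ultimately have "snd_part v = 0" by (rule kernel)
    with fst0 have "v $ s = 0" for s
      by (cases s) (simp_all add: fst_part_def snd_part_def vec_eq_iff)
    then show ?thesis by (simp add: vec_eq_iff)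
  qed
  then have "inj ((*v) G)"
    by (metis matrix_left_invertible_injective matrix_left_invertible_ker)
  then have "surj ((*v) G)"
    using dims by (intro vec.linear_injective_imp_surjective) (simp_all add: vec_dim_card del: vec.dim_UNIV)
  then obtain v where "G *v v = (\<chi> r. case r of None \<Rightarrow> 0 | Some p \<Rightarrow> w $ p)"
    by (metis surjD)
  then have "(G *v v) $ Some p = w $ p" for p by simp
  then have "w = combine y (fst_part v) + M *v snd_part v"
    unfolding G_Some by (simp add: vec_eq_iff)
  then show thesis by (rule that)
qed

lemma simple_decomposition:
  fixes A0 :: "complex^'l^'k" and A :: "'m::finite \<Rightarrow> complex^'l^'k" and y :: "'m \<Rightarrow> complex^'k"
  assumes dims: "CARD('k) = CARD('l) + CARD('m) - 1"
    and simple: "algebraically_simple A0 A \<mu>" and eigen: "eigenpair A0 A \<mu> x"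
    and orth: "orthonormal_family y"
    and null: "\<forall>i. y i \<in> left_null_space (pencil A0 A \<mu>)"
  shows "\<exists>a z. w = combine y a + pencil A0 A \<mu> *v z"
proof -
  have Mx: "pencil A0 A \<mu> *v x = 0" using eigen by (simp add: eigenpair_def)
  obtain k where xk: "x $ k \<noteq> 0" using eigen by (auto simp: eigenpair_def vec_eq_iff)
  have "0 < CARD('l)" by simp
  then have "CARD('k) + 1 = CARD('m) + CARD('l)" using dims by linarith
  from combine_add_range_surj[OF this orth null, where k = k and w = w]
  show ?thesis using simple_kernel[OF simple Mx xk] by blast
qed

lemma aux_matrix_mult: "aux_matrix A x y *v c = coords y (\<Sum>j\<in>UNIV. c $ j *s (A j *v x))"
  by (simp add: aux_matrix_def coords_def matrix_vector_mult_def vec_eq_iff hdot_sum_right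
      hdot_scale_right mult.commute)

lemma invertible_aux_matrix:
  fixes A0 :: "complex^'l^'k" and A :: "'m::finite \<Rightarrow> complex^'l^'k"
  assumes simple: "algebraically_simple A0 A \<mu>" and eigen: "eigenpair A0 A \<mu> x"
    and orth: "orthonormal_family y"
    and decomp: "\<And>w. \<exists>a z. w = combine y a + pencil A0 A \<mu> *v z"
    and null: "\<forall>i. y i \<in> left_null_space (pencil A0 A \<mu>)"
  shows "invertible (aux_matrix A x y)"
  unfolding invertible_left_inverse matrix_left_invertible_ker
proof (intro allI impI)
  fix c assume Bc: "aux_matrix A x y *v c = 0"
  obtain a z where az: "(\<Sum>j\<in>UNIV. c $ j *s (A j *v x)) = combine y a + pencil A0 A \<mu> *v z"
    using decomp by blast
  have "a = aux_matrix A x y *v c"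
    by (simp add: aux_matrix_mult az coords_add coords_combine[OF orth] coords_range[OF null])
  then have "(\<Sum>j\<in>UNIV. c $ j *s (A j *v x)) = pencil A0 A \<mu> *v z"
    using az Bc by (simp add: combine_def)
  then show "c = 0" by (rule simple_direction[OF simple eigen])
qed

section \<open>Spectral norm\<close>

lemma norm_mult_le_spectral_norm: "norm (M *v v) \<le> spectral_norm M * norm v"
  for M :: "complex^'n^'p"
  unfolding spectral_norm_def by (rule onorm) (rule matrix_vector_mul_bounded_linear)

lemma spectral_norm_nonneg: "0 \<le> spectral_norm M" for M :: "complex^'n^'p"
  unfolding spectral_norm_def by (rule onorm_pos_le) (rule matrix_vector_mul_bounded_linear)

definition rank_one :: "complex^'p \<Rightarrow> complex^'n \<Rightarrow> complex^'n^'p" where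
  "rank_one p v = (\<chi> r c. p $ r * cnj (v $ c))"

lemma rank_one_mult: "rank_one p v *v z = hdot v z *s p"
  by (simp add: rank_one_def matrix_vector_mult_def hdot_def vec_eq_iff sum_distrib_left ac_simps)

lemma spectral_norm_rank_one: "spectral_norm (rank_one p v) \<le> norm p * norm v"
  unfolding spectral_norm_def
proof (rule onorm_le)
  fix z
  have "norm (rank_one p v *v z) = norm (hdot v z) * norm p"
    by (simp add: rank_one_mult norm_vector_scale)
  also have "\<dots> \<le> (norm v * norm z) * norm p"
    by (intro mult_right_mono norm_hdot_le) simp
  finally show "norm (rank_one p v *v z) \<le> norm p * norm v * norm z" by (simp add: ac_simps)
qed

lemma matrix_inv_cancel:
  fixes B :: "complex^'m^'m"
  assumes "invertible B"
  shows "matrix_inv B *v (B *v v) = v" and "B *v (matrix_inv B *v v) = v"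
proof -
  have "B ** matrix_inv B = mat 1 \<and> matrix_inv B ** B = mat 1"
    using assms unfolding invertible_def matrix_inv_def by (rule someI_ex)
  then show "matrix_inv B *v (B *v v) = v" and "B *v (matrix_inv B *v v) = v"
    by (simp_all add: matrix_vector_mul_assoc)
qed

section \<open>Bounds for the eigenvalue shifts\<close>

text \<open>
  The quantity \<open>\<gamma>\<close> of the condition number, at an arbitrary parameter: perturbations of size \<open>\<epsilon>\<close> change the
  pencil at \<open>\<nu>\<close> by at most \<open>\<epsilon>\<close> times this amount.
\<close>

definition pencil_tolerance ::
  "complex^'l^'k \<Rightarrow> ('m::finite \<Rightarrow> complex^'l^'k) \<Rightarrow> complex^'m \<Rightarrow> real" where
  "pencil_tolerance E0 E \<nu> = spectral_norm E0 + (\<Sum>i\<in>UNIV. norm (\<nu> $ i) * spectral_norm (E i))"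

lemma pencil_tolerance_nonneg: "0 \<le> pencil_tolerance E0 E \<nu>"
  by (simp add: pencil_tolerance_def spectral_norm_nonneg sum_nonneg)

lemma perturbed_expansion:
  "pencil (A0 + D0) (\<lambda>i. A i + D i) (\<mu> + \<delta>) *v v =
    pencil A0 A \<mu> *v v + (D0 *v v + (\<Sum>i\<in>UNIV. \<mu> $ i *s (D i *v v)))
      + (\<Sum>i\<in>UNIV. \<delta> $ i *s ((A i + D i) *v v))"
  by (simp add: pencil_mult matrix_vector_mult_add_rdistrib algebra_simps sum.distrib)

text \<open>
  The subtracted term in the first factor collects the products of \<open>\<delta>\<close> with a perturbation of \<open>A\<^sub>j x\<close>; it
  vanishes with \<open>\<epsilon>\<close> and \<open>r\<close>, uniformly in the perturbation.
\<close>

lemma shift_upper_bound: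
  fixes A0 E0 :: "complex^'l^'k" and A E :: "'m::finite \<Rightarrow> complex^'l^'k"
  assumes eigen: "eigenpair A0 A \<mu> x" and x_unit: "norm x = 1"
    and orth: "orthonormal_family y"
    and null: "\<forall>i. y i \<in> left_null_space (pencil A0 A \<mu>)"
    and inv: "invertible (aux_matrix A x y)"
    and \<epsilon>: "0 \<le> \<epsilon>"
    and mem: "\<delta> \<in> eigenvalue_shifts A0 A E0 E \<mu> x \<epsilon> r"
  defines "\<beta> \<equiv> spectral_norm (matrix_inv (aux_matrix A x y))"
  shows "(1 - \<beta> * (\<Sum>j\<in>UNIV. spectral_norm (A j) * r + \<epsilon> * spectral_norm (E j) * (1 + r))) * norm \<delta>
    \<le> \<epsilon> * (\<beta> * pencil_tolerance E0 E \<mu> * (1 + r))"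
proof -
  obtain D0 D \<Delta>x where D0: "spectral_norm D0 \<le> \<epsilon> * spectral_norm E0"
    and D: "\<And>i. spectral_norm (D i) \<le> \<epsilon> * spectral_norm (E i)"
    and \<Delta>x: "norm \<Delta>x \<le> r"
    and zero: "pencil (A0 + D0) (\<lambda>i. A i + D i) (\<mu> + \<delta>) *v (x + \<Delta>x) = 0"
    using mem by (auto simp: eigenvalue_shifts_def)
  define v where "v = x + \<Delta>x"
  define f where "f = D0 *v v + (\<Sum>i\<in>UNIV. \<mu> $ i *s (D i *v v))"
  define e where "e j = A j *v \<Delta>x + D j *v v" for j
  define \<eta> where "\<eta> j = spectral_norm (A j) * r + \<epsilon> * spectral_norm (E j) * (1 + r)" for j
  have v: "norm v \<le> 1 + r"
    unfolding v_def using norm_triangle_ineq[of x \<Delta>x] x_unit \<Delta>x by linarith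
  have D0v: "norm (D0 *v v) \<le> \<epsilon> * spectral_norm E0 * (1 + r)"
    by (rule order_trans[OF norm_mult_le_spectral_norm])
      (intro mult_mono D0 v mult_nonneg_nonneg \<epsilon> spectral_norm_nonneg norm_ge_zero)
  have Dv: "norm (D i *v v) \<le> \<epsilon> * spectral_norm (E i) * (1 + r)" for i
    by (rule order_trans[OF norm_mult_le_spectral_norm])
      (intro mult_mono D v mult_nonneg_nonneg \<epsilon> spectral_norm_nonneg norm_ge_zero)
  have f: "norm f \<le> \<epsilon> * pencil_tolerance E0 E \<mu> * (1 + r)"
  proof -
    have "norm f \<le> norm (D0 *v v) + (\<Sum>i\<in>UNIV. norm (\<mu> $ i) * norm (D i *v v))"
      unfolding f_def
      by (rule order_trans[OF norm_triangle_ineq])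
        (simp add: norm_vector_scale[symmetric] norm_sum)
    also have "\<dots> \<le> \<epsilon> * spectral_norm E0 * (1 + r)
        + (\<Sum>i\<in>UNIV. norm (\<mu> $ i) * (\<epsilon> * spectral_norm (E i) * (1 + r)))"
      by (intro add_mono D0v sum_mono mult_left_mono Dv norm_ge_zero)
    also have "\<dots> = \<epsilon> * pencil_tolerance E0 E \<mu> * (1 + r)"
      by (simp add: pencil_tolerance_def distrib_left distrib_right sum_distrib_left sum_distrib_right
          ac_simps)
    finally show ?thesis .
  qed
  have e: "norm (e j) \<le> \<eta> j" for j
  proof -
    have "norm (A j *v \<Delta>x) \<le> spectral_norm (A j) * r"
      by (rule order_trans[OF norm_mult_le_spectral_norm])
        (intro mult_left_mono \<Delta>x spectral_norm_nonneg)
    then show ?thesis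
      unfolding e_def \<eta>_def using norm_triangle_ineq[of "A j *v \<Delta>x" "D j *v v"] Dv[of j] by linarith
  qed
  have "pencil A0 A \<mu> *v v + f + (\<Sum>j\<in>UNIV. \<delta> $ j *s ((A j + D j) *v v)) = 0"
    using zero unfolding perturbed_expansion f_def v_def .
  moreover have "(\<Sum>j\<in>UNIV. \<delta> $ j *s ((A j + D j) *v v)) =
      (\<Sum>j\<in>UNIV. \<delta> $ j *s (A j *v x)) + (\<Sum>j\<in>UNIV. \<delta> $ j *s e j)"
    by (simp add: e_def v_def matrix_vector_mult_add_rdistrib matrix_vector_right_distrib
        sum.distrib algebra_simps)
  \<comment> \<open>Projection onto the left null space removes the unknown \<open>\<Delta>x\<close> to first order.\<close>
  ultimately have "coords y (pencil A0 A \<mu> *v v + (\<Sum>j\<in>UNIV. \<delta> $ j *s (A j *v x))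
      + (f + (\<Sum>j\<in>UNIV. \<delta> $ j *s e j))) = coords y 0"
    by (simp add: algebra_simps)
  then have "aux_matrix A x y *v \<delta> + coords y (f + (\<Sum>j\<in>UNIV. \<delta> $ j *s e j)) = 0"
    unfolding coords_add coords_range[OF null] aux_matrix_mult
    by (simp add: coords_def hdot_def vec_eq_iff)
  then have "norm (aux_matrix A x y *v \<delta>) = norm (coords y (f + (\<Sum>j\<in>UNIV. \<delta> $ j *s e j)))"
    by (metis add_eq_0_iff norm_minus_cancel)
  also have "\<dots> \<le> norm (f + (\<Sum>j\<in>UNIV. \<delta> $ j *s e j))" by (rule bessel[OF orth])
  also have "\<dots> \<le> norm f + (\<Sum>j\<in>UNIV. norm (\<delta> $ j) * norm (e j))"
    by (rule order_trans[OF norm_triangle_ineq]) (simp add: norm_vector_scale[symmetric] norm_sum)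
  also have "\<dots> \<le> \<epsilon> * pencil_tolerance E0 E \<mu> * (1 + r) + (\<Sum>j\<in>UNIV. norm \<delta> * \<eta> j)"
    by (intro add_mono f sum_mono mult_mono e norm_ge_zero Finite_Cartesian_Product.norm_nth_le)
  finally have B\<delta>: "norm (aux_matrix A x y *v \<delta>)
      \<le> \<epsilon> * pencil_tolerance E0 E \<mu> * (1 + r) + norm \<delta> * (\<Sum>j\<in>UNIV. \<eta> j)"
    by (simp add: sum_distrib_left)
  have "norm \<delta> = norm (matrix_inv (aux_matrix A x y) *v (aux_matrix A x y *v \<delta>))"
    by (simp add: matrix_inv_cancel[OF inv])
  also have "\<dots> \<le> \<beta> * norm (aux_matrix A x y *v \<delta>)"
    unfolding \<beta>_def by (rule norm_mult_le_spectral_norm)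
  also have "\<dots> \<le> \<beta> * (\<epsilon> * pencil_tolerance E0 E \<mu> * (1 + r) + norm \<delta> * (\<Sum>j\<in>UNIV. \<eta> j))"
    unfolding \<beta>_def by (intro mult_left_mono B\<delta> spectral_norm_nonneg)
  finally show ?thesis
    by (simp add: \<eta>_def algebra_simps)
qed

text \<open>
  A normwise backward error bound of Rigal-Gaches type. The residual is distributed over the coefficient
  matrices in proportion to \<open>\<parallel>E\<^sub>i\<parallel>\<close>; the conjugate phase of \<open>\<nu>\<^sub>i\<close> aligns the contributions, so that the
  weights add up to the full tolerance.
\<close>

lemma backward_error:
  fixes A0 E0 :: "complex^'l^'k" and A E :: "'m::finite \<Rightarrow> complex^'l^'k"
  assumes \<epsilon>: "0 \<le> \<epsilon>"
    and residual: "norm (pencil A0 A \<nu> *v v) \<le> \<epsilon> * pencil_tolerance E0 E \<nu> * norm v"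
  obtains D0 D where "spectral_norm D0 \<le> \<epsilon> * spectral_norm E0"
    and "\<And>i. spectral_norm (D i) \<le> \<epsilon> * spectral_norm (E i)"
    and "pencil (A0 + D0) (\<lambda>i. A i + D i) \<nu> *v v = 0"
proof (cases "pencil A0 A \<nu> *v v = 0")
  case True
  have "spectral_norm (0 :: complex^'l^'k) = 0"
    by (simp add: spectral_norm_def onorm_zero)
  with True \<epsilon> show thesis
    by (intro that[of 0 "\<lambda>_. 0"]) (simp_all add: spectral_norm_nonneg)
next
  case False
  define R where "R = pencil A0 A \<nu> *v v"
  define g where "g = pencil_tolerance E0 E \<nu>"
  have "0 < \<epsilon> * g * norm v"
    using residual False by (metis g_def order_less_le_trans zero_less_norm_iff)
  then have g: "g \<noteq> 0" and v: "v \<noteq> 0" by auto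
  have g_pos: "0 < g" using g pencil_tolerance_nonneg[of E0 E \<nu>] by (simp add: g_def)
  \<comment> \<open>The matrix of least norm that maps \<open>v\<close> to \<open>- \<sigma> (\<parallel>F\<parallel> / g) R\<close>.\<close>
  define D where "D \<sigma> F = rank_one (- (\<sigma> * of_real (spectral_norm F / (g * (norm v)\<^sup>2))) *s R) v"
    for \<sigma> :: complex and F :: "complex^'l^'k"
  have bound: "spectral_norm (D \<sigma> F) \<le> \<epsilon> * spectral_norm F" if "norm \<sigma> \<le> 1" for \<sigma> F
  proof -
    have "spectral_norm (D \<sigma> F) \<le> norm \<sigma> * (spectral_norm F / (g * (norm v)\<^sup>2)) * norm R * norm v"
      unfolding D_def using spectral_norm_nonneg[of F] g_pos
      by (intro order_trans[OF spectral_norm_rank_one])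
        (simp add: norm_vector_scale norm_mult norm_divide norm_power)
    also have "\<dots> \<le> 1 * (spectral_norm F / (g * (norm v)\<^sup>2)) * (\<epsilon> * g * norm v) * norm v"
      using residual spectral_norm_nonneg[of F] g_pos that \<epsilon>
      by (intro mult_right_mono mult_mono) (simp_all add: R_def g_def)
    also have "\<dots> = \<epsilon> * spectral_norm F"
      using g v by (simp add: field_simps power2_eq_square)
    finally show ?thesis .
  qed
  have act: "D \<sigma> F *v v = - (\<sigma> * of_real (spectral_norm F / g)) *s R" for \<sigma> F
  proof -
    have "complex_of_real ((norm v)\<^sup>2) * of_real (spectral_norm F / (g * (norm v)\<^sup>2))
        = of_real (spectral_norm F / g)"
      unfolding of_real_mult[symmetric] using v by simp
    then show ?thesis
      by (simp add: D_def rank_one_mult hdot_self vector_smult_assoc mult.left_commute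
          del: of_real_power of_real_divide of_real_mult)
  qed
  have "\<nu> $ i *s (D (cnj (sgn (\<nu> $ i))) (E i) *v v)
      = - of_real (norm (\<nu> $ i) * spectral_norm (E i) / g) *s R" for i
  proof -
    have "\<nu> $ i * cnj (sgn (\<nu> $ i)) = of_real (norm (\<nu> $ i))"
      by (cases "\<nu> $ i = 0")
        (simp_all add: sgn_eq complex_norm_square[symmetric] power2_eq_square)
    then show ?thesis by (simp add: act vec_eq_iff mult.assoc[symmetric])
  qed
  then have weighted: "(\<Sum>i\<in>UNIV. \<nu> $ i *s (D (cnj (sgn (\<nu> $ i))) (E i) *v v))
      = (\<Sum>i\<in>UNIV. - of_real (norm (\<nu> $ i) * spectral_norm (E i) / g) *s R)"
    by (intro sum.cong refl)
  have "pencil (A0 + D 1 E0) (\<lambda>i. A i + D (cnj (sgn (\<nu> $ i))) (E i)) \<nu> *v v =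
      R + - of_real (spectral_norm E0 / g) *s R
        + (\<Sum>i\<in>UNIV. - of_real (norm (\<nu> $ i) * spectral_norm (E i) / g) *s R)"
    using perturbed_expansion[of A0 "D 1 E0" A "\<lambda>i. D (cnj (sgn (\<nu> $ i))) (E i)" \<nu> 0 v]
    unfolding weighted by (simp add: act R_def add.assoc)
  also have "\<dots> = (1 - of_real (spectral_norm E0 / g)
        - (\<Sum>i\<in>UNIV. of_real (norm (\<nu> $ i) * spectral_norm (E i) / g))) *s R"
    by (simp add: vec_eq_iff sum_distrib_left sum_negf algebra_simps)
  also have "1 - of_real (spectral_norm E0 / g)
        - (\<Sum>i\<in>UNIV. of_real (norm (\<nu> $ i) * spectral_norm (E i) / g)) = complex_of_real (1 - g / g)"
  proof -
    have "g = spectral_norm E0 + (\<Sum>i\<in>UNIV. norm (\<nu> $ i) * spectral_norm (E i))"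
      by (simp add: g_def pencil_tolerance_def)
    from arg_cong[OF this, of "\<lambda>t. t / g"]
    have "g / g = spectral_norm E0 / g + (\<Sum>i\<in>UNIV. norm (\<nu> $ i) * spectral_norm (E i) / g)"
      by (simp only: add_divide_distrib sum_divide_distrib)
    then show ?thesis by (simp only:) (simp del: of_real_mult of_real_divide)
  qed
  finally have "pencil (A0 + D 1 E0) (\<lambda>i. A i + D (cnj (sgn (\<nu> $ i))) (E i)) \<nu> *v v = 0"
    using g by simp
  moreover have "norm (cnj (sgn (\<nu> $ i))) \<le> 1" for i by (simp add: norm_sgn)
  ultimately show thesis
    using that[of "D 1 E0" "\<lambda>i. D (cnj (sgn (\<nu> $ i))) (E i)"] bound by simp
qed

text \<open>
  The shift is the first-order response to a perturbation that acts on \<open>x\<close> as \<open>\<theta> \<epsilon> \<gamma> Y u\<close>. The margin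
  \<open>1 - \<theta>\<close> absorbs the second-order terms, so that the perturbed equation can hold exactly.
\<close>

lemma shift_lower_bound:
  fixes A0 E0 :: "complex^'l^'k" and A E :: "'m::finite \<Rightarrow> complex^'l^'k"
  assumes eigen: "eigenpair A0 A \<mu> x" and x_unit: "norm x = 1"
    and orth: "orthonormal_family y"
    and null: "\<forall>i. y i \<in> left_null_space (pencil A0 A \<mu>)"
    and inv: "invertible (aux_matrix A x y)"
    and decomp: "\<And>w. \<exists>a z. w = combine y a + pencil A0 A \<mu> *v z"
    and u: "norm u = 1" and \<theta>: "0 < \<theta>" "\<theta> < 1" and \<gamma>: "0 < pencil_tolerance E0 E \<mu>"
  shows "\<exists>C. \<forall>\<^sub>F \<epsilon> in at_right 0.
    of_real (- (\<theta> * pencil_tolerance E0 E \<mu> * \<epsilon>)) *s (matrix_inv (aux_matrix A x y) *v u)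
      \<in> eigenvalue_shifts A0 A E0 E \<mu> x \<epsilon> (C * \<epsilon>)"
proof -
  define \<gamma>' where "\<gamma>' = pencil_tolerance E0 E \<mu>"
  define M where "M = pencil A0 A \<mu>"
  define d where "d = - (matrix_inv (aux_matrix A x y) *v u)"
  define s where "s \<epsilon> = \<theta> * \<gamma>' * \<epsilon>" for \<epsilon> :: real
  obtain a z where az: "(\<Sum>j\<in>UNIV. d $ j *s (A j *v x)) = combine y a + M *v z"
    using decomp unfolding M_def by blast
  have "a = aux_matrix A x y *v d"
    using null
    by (simp add: aux_matrix_mult az coords_add coords_combine[OF orth] coords_range M_def)
  also have "\<dots> = - u"
    using matrix_inv_cancel(2)[OF inv, of u] matrix_vector_mult_diff_distrib[of "aux_matrix A x y" 0]
    by (simp add: d_def)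
  finally have a: "norm a = 1" using u by simp
  have Mx: "M *v x = 0" using eigen by (simp add: eigenpair_def M_def)
  define q where "q = (\<Sum>j\<in>UNIV. d $ j *s (A j *v z))"
  \<comment> \<open>Subtracting \<open>t z\<close> from the eigenvector cancels the component \<open>M z\<close> of \<open>\<Sum>\<^sub>j d\<^sub>j A\<^sub>j x\<close>.\<close>
  define v where "v t = x - of_real t *s z" for t :: real
  define w where "w t = pencil_tolerance E0 E (\<mu> + of_real t *s d)" for t :: real
  have residual: "norm (pencil A0 A (\<mu> + of_real t *s d) *v v t) \<le> t * (1 + t * norm q)"
    if "0 \<le> t" for t
  proof -
    have "pencil A0 A (\<mu> + of_real t *s d) *v v t =
        M *v v t + of_real t *s (\<Sum>j\<in>UNIV. d $ j *s (A j *v v t))"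
      using perturbed_expansion[of A0 0 A "\<lambda>_. 0" \<mu> "of_real t *s d" "v t"]
      by (simp add: M_def vec_eq_iff sum_distrib_left mult.assoc)
    also have "M *v v t = - of_real t *s (M *v z)"
      by (simp add: v_def matrix_vector_mult_diff_distrib Mx vector_scalar_commute)
    also have "(\<Sum>j\<in>UNIV. d $ j *s (A j *v v t)) = (combine y a + M *v z) - of_real t *s q"
      unfolding az[symmetric] q_def v_def
      by (simp add: matrix_vector_mult_diff_distrib vector_scalar_commute sum_subtractf vec_eq_iff
          sum_distrib_left algebra_simps)
    finally have "pencil A0 A (\<mu> + of_real t *s d) *v v t =
        of_real t *s (combine y a - of_real t *s q)"
      by (simp add: vec_eq_iff algebra_simps)
    then have "norm (pencil A0 A (\<mu> + of_real t *s d) *v v t) = t * norm (combine y a - of_real t *s q)"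
      using that by (simp only: norm_vector_scale) simp
    also have "norm (combine y a - of_real t *s q) \<le> 1 + t * norm q"
      using norm_triangle_ineq4[of "combine y a" "of_real t *s q"] that
      by (simp add: norm_combine[OF orth] a norm_vector_scale)
    finally show ?thesis using that by (simp add: mult_left_mono)
  qed
  have "0 < \<theta> * \<gamma>'" and less: "\<theta> * \<gamma>' < \<gamma>'" using \<theta> \<gamma> by (simp_all add: \<gamma>'_def)
  have s0: "(s \<longlongrightarrow> 0) (at_right 0)"
    unfolding s_def[abs_def] by (auto intro!: tendsto_eq_intros)
  have w0: "((\<lambda>\<epsilon>. w (s \<epsilon>)) \<longlongrightarrow> \<gamma>') (at_right 0)"
    unfolding w_def pencil_tolerance_def \<gamma>'_def by (auto intro!: tendsto_eq_intros s0)
  have "((\<lambda>\<epsilon>. w (s \<epsilon>) * (1 - s \<epsilon> * norm z) - \<theta> * \<gamma>' * (1 + s \<epsilon> * norm q)) \<longlongrightarrow> \<gamma>' - \<theta> * \<gamma>') (at_right 0)"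
    by (auto intro!: tendsto_eq_intros s0 w0)
  then have "\<forall>\<^sub>F \<epsilon> in at_right 0. 0 < w (s \<epsilon>) * (1 - s \<epsilon> * norm z) - \<theta> * \<gamma>' * (1 + s \<epsilon> * norm q)"
    by (rule order_tendstoD) (use less in simp)
  moreover have "\<forall>\<^sub>F \<epsilon> in at_right (0::real). 0 < \<epsilon>" by (rule eventually_at_right_less)
  ultimately have "\<forall>\<^sub>F \<epsilon> in at_right 0.
    of_real (s \<epsilon>) *s d \<in> eigenvalue_shifts A0 A E0 E \<mu> x \<epsilon> ((\<theta> * \<gamma>' * norm z) * \<epsilon>)"
  proof eventually_elim
    case (elim \<epsilon>)
    have s_nonneg: "0 \<le> s \<epsilon>" using elim \<open>0 < \<theta> * \<gamma>'\<close> by (simp add: s_def)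
    have "norm (pencil A0 A (\<mu> + of_real (s \<epsilon>) *s d) *v v (s \<epsilon>)) \<le> \<epsilon> * (\<theta> * \<gamma>' * (1 + s \<epsilon> * norm q))"
      using residual[OF s_nonneg] by (simp add: s_def ac_simps)
    also have "\<dots> \<le> \<epsilon> * (w (s \<epsilon>) * (1 - s \<epsilon> * norm z))"
      using elim by (intro mult_left_mono) simp_all
    also have "\<dots> \<le> \<epsilon> * (w (s \<epsilon>) * norm (v (s \<epsilon>)))"
    proof -
      have "1 - s \<epsilon> * norm z \<le> norm (v (s \<epsilon>))"
        using norm_triangle_ineq2[of x "of_real (s \<epsilon>) *s z"] s_nonneg x_unit
        by (simp add: v_def norm_vector_scale)
      then show ?thesis
        using elim by (intro mult_left_mono) (simp_all add: w_def pencil_tolerance_nonneg)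
    qed
    finally have res: "norm (pencil A0 A (\<mu> + of_real (s \<epsilon>) *s d) *v v (s \<epsilon>))
        \<le> \<epsilon> * pencil_tolerance E0 E (\<mu> + of_real (s \<epsilon>) *s d) * norm (v (s \<epsilon>))"
      by (simp add: w_def mult.assoc)
    have "0 \<le> \<epsilon>" using elim by simp
    from this res obtain D0 D where "spectral_norm D0 \<le> \<epsilon> * spectral_norm E0"
      "\<And>i. spectral_norm (D i) \<le> \<epsilon> * spectral_norm (E i)"
      "pencil (A0 + D0) (\<lambda>i. A i + D i) (\<mu> + of_real (s \<epsilon>) *s d) *v v (s \<epsilon>) = 0"
      by (rule backward_error) blast+
    moreover have "norm (- (of_real (s \<epsilon>) *s z)) \<le> \<theta> * \<gamma>' * norm z * \<epsilon>"
      using s_nonneg by (simp add: norm_vector_scale) (simp add: s_def ac_simps)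
    moreover have "v (s \<epsilon>) = x + - (of_real (s \<epsilon>) *s z)" by (simp add: v_def)
    ultimately show ?case
      unfolding eigenvalue_shifts_def
      by (intro CollectI exI[of _ D0] exI[of _ D] exI[of _ "- (of_real (s \<epsilon>) *s z)"] conjI allI)
        simp_all
  qed
  moreover have "of_real (s \<epsilon>) *s d =
      of_real (- (\<theta> * pencil_tolerance E0 E \<mu> * \<epsilon>)) *s (matrix_inv (aux_matrix A x y) *v u)" for \<epsilon>
    by (simp add: s_def d_def \<gamma>'_def vec_eq_iff)
  ultimately show ?thesis by auto
qed

section \<open>The condition number\<close>

theorem mainTheorem3:
  fixes A0 E0 :: "complex^'l^'k"
    and A E :: "'m::finite \<Rightarrow> complex^'l^'k"
    and \<mu> :: "complex^'m"
    and x :: "complex^'l"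
    and y :: "'m \<Rightarrow> complex^'k"
  assumes dims: "CARD('k) = CARD('l) + CARD('m) - 1"
    and full_normal_rank: "normal_rank A0 A = CARD('l)"
    and nonzero: "\<mu> \<noteq> 0"
    and eigen: "eigenpair A0 A \<mu> x"
    and simple: "algebraically_simple A0 A \<mu>"
    and x_unit: "norm x = 1"
    and y_left_null: "\<forall>i. y i \<in> left_null_space (pencil A0 A \<mu>)"
    and y_orthonormal: "orthonormal_family y"
  shows "invertible (aux_matrix A x y) \<and>
    has_condition_number A0 A E0 E \<mu> x
      (spectral_norm (matrix_inv (aux_matrix A x y)) / norm \<mu> *
        (spectral_norm E0 + (\<Sum>i\<in>UNIV. norm (\<mu> $ i) * spectral_norm (E i))))"
proof
  note decomp = simple_decomposition[OF dims simple eigen y_orthonormal y_left_null]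
  show inv: "invertible (aux_matrix A x y)"
    by (rule invertible_aux_matrix[OF simple eigen y_orthonormal decomp y_left_null])
  define Binv where "Binv = matrix_inv (aux_matrix A x y)"
  define \<beta> where "\<beta> = spectral_norm Binv"
  define \<gamma> where "\<gamma> = pencil_tolerance E0 E \<mu>"
  define \<kappa> where "\<kappa> = \<beta> * \<gamma> / norm \<mu>"
  have \<mu>: "0 < norm \<mu>" using nonzero by simp
  have nonneg: "0 \<le> \<beta>" "0 \<le> \<gamma>"
    by (simp_all add: \<beta>_def \<gamma>_def spectral_norm_nonneg pencil_tolerance_nonneg)
  have pos: "\<forall>\<^sub>F \<epsilon> in at_right (0::real). 0 < \<epsilon>" by (rule eventually_at_right_less)
  have "((\<lambda>\<epsilon>. worst_relative_shift A0 A E0 E \<mu> x \<epsilon> (\<rho> \<epsilon>)) \<longlongrightarrow> ereal \<kappa>) (at_right 0)"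
    if \<rho>: "(\<rho> \<longlongrightarrow> 0) (at_right 0)" and slow: "\<forall>\<^sub>F \<epsilon> in at_right 0. sqrt \<epsilon> \<le> \<rho> \<epsilon>" for \<rho>
  proof (rule order_tendstoI)
    fix a assume a: "ereal \<kappa> < a"
    define \<eta> where "\<eta> \<epsilon> = \<beta> * (\<Sum>j\<in>UNIV. spectral_norm (A j) * \<rho> \<epsilon> + \<epsilon> * spectral_norm (E j) * (1 + \<rho> \<epsilon>))"
      for \<epsilon>
    define b where "b \<epsilon> = \<beta> * \<gamma> * (1 + \<rho> \<epsilon>) / ((1 - \<eta> \<epsilon>) * norm \<mu>)" for \<epsilon>
    have \<eta>: "(\<eta> \<longlongrightarrow> 0) (at_right 0)"
      unfolding \<eta>_def[abs_def] by (auto intro!: tendsto_eq_intros \<rho>)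
    have "(b \<longlongrightarrow> \<kappa>) (at_right 0)"
      unfolding b_def[abs_def] using nonzero by (auto intro!: tendsto_eq_intros \<rho> \<eta> simp: \<kappa>_def)
    then have "\<forall>\<^sub>F \<epsilon> in at_right 0. ereal (b \<epsilon>) < a"
      using a by (intro order_tendstoD) auto
    moreover have "\<forall>\<^sub>F \<epsilon> in at_right 0. \<eta> \<epsilon> < 1"
      by (rule order_tendstoD[OF \<eta>]) simp
    ultimately show "\<forall>\<^sub>F \<epsilon> in at_right 0. worst_relative_shift A0 A E0 E \<mu> x \<epsilon> (\<rho> \<epsilon>) < a"
      using pos
    proof eventually_elim
      case (elim \<epsilon>)
      have "norm \<delta> / (\<epsilon> * norm \<mu>) \<le> b \<epsilon>"
        if "\<delta> \<in> eigenvalue_shifts A0 A E0 E \<mu> x \<epsilon> (\<rho> \<epsilon>)" for \<delta>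
      proof -
        have "(1 - \<eta> \<epsilon>) * norm \<delta> \<le> \<epsilon> * (\<beta> * \<gamma> * (1 + \<rho> \<epsilon>))"
          unfolding \<eta>_def \<beta>_def \<gamma>_def Binv_def using elim
          by (intro shift_upper_bound[OF eigen x_unit y_orthonormal y_left_null inv _ that]) simp
        then have "norm \<delta> \<le> \<epsilon> * (\<beta> * \<gamma> * (1 + \<rho> \<epsilon>)) / (1 - \<eta> \<epsilon>)"
          using elim by (simp add: pos_le_divide_eq mult.commute)
        then have "norm \<delta> / (\<epsilon> * norm \<mu>) \<le>
            \<epsilon> * (\<beta> * \<gamma> * (1 + \<rho> \<epsilon>)) / (1 - \<eta> \<epsilon>) / (\<epsilon> * norm \<mu>)"
          using elim by (intro divide_right_mono) simp_all
        also have "\<dots> = b \<epsilon>" using elim by (simp add: b_def)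
        finally show ?thesis .
      qed
      then have "worst_relative_shift A0 A E0 E \<mu> x \<epsilon> (\<rho> \<epsilon>) \<le> ereal (b \<epsilon>)"
        unfolding worst_relative_shift_def by (intro SUP_least) simp
      then show ?case using elim by simp
    qed
  next
    fix a assume a: "a < ereal \<kappa>"
    have reach: "ereal (norm \<delta> / (\<epsilon> * norm \<mu>)) \<le> worst_relative_shift A0 A E0 E \<mu> x \<epsilon> (\<rho> \<epsilon>)"
      if "\<delta> \<in> eigenvalue_shifts A0 A E0 E \<mu> x \<epsilon> r" "r \<le> \<rho> \<epsilon>" for \<epsilon> \<delta> r
    proof -
      have "\<delta> \<in> eigenvalue_shifts A0 A E0 E \<mu> x \<epsilon> (\<rho> \<epsilon>)"
        using that unfolding eigenvalue_shifts_def by (blast intro: order_trans)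
      then show ?thesis unfolding worst_relative_shift_def by (rule SUP_upper)
    qed
    show "\<forall>\<^sub>F \<epsilon> in at_right 0. a < worst_relative_shift A0 A E0 E \<mu> x \<epsilon> (\<rho> \<epsilon>)"
    proof (cases "\<kappa> = 0")
      case True
      \<comment> \<open>The limit is 0, and the zero shift is always available.\<close>
      show ?thesis using pos slow
      proof eventually_elim
        case (elim \<epsilon>)
        have "spectral_norm (0 :: complex^'l^'k) = 0"
          by (simp add: spectral_norm_def onorm_zero)
        then have "0 \<in> eigenvalue_shifts A0 A E0 E \<mu> x \<epsilon> 0"
          using eigen elim unfolding eigenvalue_shifts_def eigenpair_def
          by (intro CollectI exI[of _ 0] exI[of _ "\<lambda>_. 0"]) (simp add: spectral_norm_nonneg)
        moreover have "0 \<le> \<rho> \<epsilon>" using elim real_sqrt_ge_zero[of \<epsilon>] by linarith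
        ultimately have "ereal 0 \<le> worst_relative_shift A0 A E0 E \<mu> x \<epsilon> (\<rho> \<epsilon>)"
          using reach[of 0 \<epsilon> 0] by simp
        then show ?case using a True by simp
      qed
    next
      case False
      then have \<kappa>: "0 < \<kappa>" and \<gamma>: "0 < \<gamma>" using nonneg \<mu> by (auto simp: \<kappa>_def less_le)
      then have "max a 0 < ereal \<kappa>" using a by simp
      then obtain b where ab: "max a 0 < ereal b" and b\<kappa>: "ereal b < ereal \<kappa>"
        using ereal_dense2 by blast
      have b: "0 < b" "b < \<kappa>" "a < ereal b" using ab b\<kappa> by simp_all
      then have "b * norm \<mu> / \<gamma> < \<beta>" using \<gamma> \<mu> by (simp add: \<kappa>_def field_simps)
      then obtain c where c: "b * norm \<mu> / \<gamma> < c" "c < \<beta>" using dense by blast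
      have "0 < b * norm \<mu> / \<gamma>" using b \<mu> \<gamma> by simp
      then have c0: "0 < c" using c by linarith
      \<comment> \<open>A nearly maximizing direction \<open>u\<close> of \<open>B\<inverse>\<close>; the slack between \<open>c\<close> and \<open>\<beta>\<close> also leaves room for \<open>\<theta> < 1\<close>.\<close>
      have "\<not> (\<forall>v. norm (Binv *v v) \<le> c * norm v)"
        using c onorm_le[of "(*v) Binv" c] by (auto simp: \<beta>_def spectral_norm_def)
      then obtain v where v: "c * norm v < norm (Binv *v v)" by (auto simp: not_le)
      then have v0: "v \<noteq> 0" by auto
      define u where "u = of_real (1 / norm v) *s v"
      have u: "norm u = 1" using v0 by (simp add: u_def norm_vector_scale norm_divide)
      have Bu_eq: "norm (Binv *v u) = norm (Binv *v v) / norm v"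
        by (simp add: u_def vector_scalar_commute norm_vector_scale norm_divide)
      have Bu: "c < norm (Binv *v u)"
        unfolding Bu_eq using v v0 by (simp add: pos_less_divide_eq)
      define \<theta> where "\<theta> = b * norm \<mu> / (\<gamma> * c)"
      have \<theta>: "0 < \<theta>" "\<theta> < 1" using b \<mu> \<gamma> c0 c by (simp_all add: \<theta>_def field_simps)
      have "b < \<theta> * \<gamma> * norm (Binv *v u) / norm \<mu>"
        using Bu \<gamma> c0 \<mu> b by (simp add: \<theta>_def field_simps)
      define \<delta> where "\<delta> \<epsilon> = of_real (- (\<theta> * \<gamma> * \<epsilon>)) *s (Binv *v u)" for \<epsilon> :: real
      obtain C where C: "\<forall>\<^sub>F \<epsilon> in at_right 0. \<delta> \<epsilon> \<in> eigenvalue_shifts A0 A E0 E \<mu> x \<epsilon> (C * \<epsilon>)"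
        using shift_lower_bound[OF eigen x_unit y_orthonormal y_left_null inv decomp u \<theta>
            \<gamma>[unfolded \<gamma>_def]]
        unfolding \<delta>_def Binv_def \<gamma>_def by blast
      have "((\<lambda>\<epsilon>. C * sqrt \<epsilon>) \<longlongrightarrow> 0) (at_right 0)" by (auto intro!: tendsto_eq_intros)
      then have "\<forall>\<^sub>F \<epsilon> in at_right 0. C * sqrt \<epsilon> < 1" by (rule order_tendstoD) simp
      from this C pos slow show ?thesis
      proof eventually_elim
        case (elim \<epsilon>)
        have "C * \<epsilon> = (C * sqrt \<epsilon>) * sqrt \<epsilon>" using elim by simp
        also have "\<dots> \<le> 1 * sqrt \<epsilon>" using elim by (intro mult_right_mono) simp_all
        finally have "C * \<epsilon> \<le> \<rho> \<epsilon>" using elim by simp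
        note reach[OF elim(2) this]
        moreover have "norm (\<delta> \<epsilon>) / (\<epsilon> * norm \<mu>) = \<theta> * \<gamma> * norm (Binv *v u) / norm \<mu>"
          using elim \<theta> \<gamma> by (simp add: \<delta>_def norm_vector_scale norm_mult)
        ultimately have "ereal b \<le> worst_relative_shift A0 A E0 E \<mu> x \<epsilon> (\<rho> \<epsilon>)"
          using \<open>b < \<theta> * \<gamma> * norm (Binv *v u) / norm \<mu>\<close>
          by (auto elim!: order_trans[rotated])
        then show ?case by (rule less_le_trans[OF b(3)])
      qed
    qed
  qed
  moreover have "(sqrt \<longlongrightarrow> 0) (at_right 0)"
    using tendsto_real_sqrt[OF tendsto_ident_at[of 0 "{0<..}"]] by simp
  moreover have "\<kappa> = spectral_norm (matrix_inv (aux_matrix A x y)) / norm \<mu> *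
        (spectral_norm E0 + (\<Sum>i\<in>UNIV. norm (\<mu> $ i) * spectral_norm (E i)))"
    by (simp add: \<kappa>_def \<beta>_def \<gamma>_def Binv_def pencil_tolerance_def)
  ultimately show "has_condition_number A0 A E0 E \<mu> x
      (spectral_norm (matrix_inv (aux_matrix A x y)) / norm \<mu> *
        (spectral_norm E0 + (\<Sum>i\<in>UNIV. norm (\<mu> $ i) * spectral_norm (E i))))"
    unfolding has_condition_number_def by (intro exI[of _ sqrt]) auto
qed

end
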